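(* Let $g_\tau:\mathbb{R}\to\mathbb{R}$ be concave and increasing, let $s_\tau$, $\mathcal{M}$ and $Q$ be as in the context, and let $b\in\mathbb{R}^D$. Then: (1) $Q(\cdot\,|\,b)$ is convex and $Q(\cdot\,|\,\cdot)$ majorizes $s_\tau(\cdot)$ at $b$, i.e. $Q(b|b)=s_\tau(b)$ and $s_\tau(\beta)\le Q(\beta|b)$ for all $\beta\in\mathbb{R}^D$. (2) The quantity $\mathcal{M}(V^{|b|},g_\tau'(\lambda^{|b|}))$ does not depend on the choice of the orthonormal eigenvectors $V^{|b|}$ of $\mathcal{L}(|b|)$. (3) Majorizing at $0$ leaves a Lasso: $Q(\beta|0)=g'_\tau(0)\|\beta\|_1$ up to an additive constant not depending on $\beta$. (4) Any fixed point of the majorization-minimization (LLA) algorithm, i.e. any $\beta\in\operatorname{argmin}_{x\in\mathbb{R}^D}\ \ell(x)+Q(x|\beta)$, is a stationary point of the problem $\min_{\beta\in\mathbb{R}^D}\ \ell(\beta)+s_\tau(\beta)$.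
   Context: $D=\binom d2$; vectors $x\in\mathbb{R}^D$ are indexed by unordered pairs $(ij)$, $i\ne j\in[d]$. $\mathcal{A}(x)\in\mathbb{R}^{d\times d}$ is the symmetric matrix with zero diagonal and entries $\mathcal{A}(x)_{ij}=x_{(ij)}$; $\mathcal{L}(x)=\mathrm{diag}(\mathcal{A}(x)\mathbf 1_d)-\mathcal{A}(x)$ is its Laplacian; $|x|$ is the entrywise absolute value. The folded concave Laplacian spectral (FCLS) penalty is $s_\tau(\beta)=\frac12\sum_{i=1}^d g_\tau(\lambda_i(\mathcal{L}(|\beta|)))$, where $\lambda_i$ are the eigenvalues. $g_\tau'(t)$ denotes a (fixed choice of) super-gradient of $g_\tau$ at $t$, applied entrywise to vectors. For $V\in\mathbb{R}^{d\times m}$, $w\in\mathbb{R}^m$, the Laplacian coefficient $\mathcal{M}(V,w)\in\mathbb{R}^D$ is $\mathcal{M}(V,w)_{(ij)}=\sum_{k=1}^m w_k(V_{ik}-V_{jk})^2$. For $b\in\mathbb{R}^D$ let $V^{|b|}\in\mathbb{R}^{d\times d}$ be any orthonormal matrix of eigenvectors of $\mathcal{L}(|b|)$ and $\lambda^{|b|}\in\mathbb{R}^d$ the corresponding eigenvalues, and define $$Q(\beta|b)=\tfrac12\sum_{(ij)}\mathcal{M}(V^{|b|},g'_\tau(\lambda^{|b|}))_{(ij)}\,|\beta_{(ij)}|+\mathrm{const}(b),$$ where the constant, depending only on $b$, is chosen so that $Q(b|b)=s_\tau(b)$. The loss $\ell:\mathbb{R}^D\to\mathbb{R}$ is differentiable.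 A stationary point of $\ell+s_\tau$ is a $\beta$ satisfying the first-order condition $0=\nabla\ell(\beta)+\frac12M\odot z$, where $M=\mathcal{M}(V^{|\beta|},g'_\tau(\lambda^{|\beta|}))$ is a super-gradient of $x\mapsto\sum_i g_\tau(\lambda_i(\mathcal{L}(x)))$ at $|\beta|$ and $z$ is some subgradient of $\|\cdot\|_1$ at $\beta$. *)

theory Defs
  imports "HOL-Analysis.Analysis" "HOL-Computational_Algebra.Polynomial"
begin

definition edges :: "'n set set" where
  "edges = {e. card e = 2}"

(* The space R^D with D = d choose 2, where d = CARD('n): real families indexed by the
   unordered pairs {i, j} of distinct elements of 'n.  The type real ^ 'e would need a nonempty
   index type 'e of pairs and so exclude d = 1 (D = 0). *)
typedef 'n edge_vec = "{x :: 'n set \<Rightarrow> real. \<forall>e. e \<notin> edges \<longrightarrow> x e = 0}"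
  morphisms entry Abs_edge_vec
  by (rule exI[of _ "\<lambda>_. 0"]) simp

definition edge_lambda :: "('n set \<Rightarrow> real) \<Rightarrow> 'n edge_vec" where
  "edge_lambda f = Abs_edge_vec (\<lambda>e. if e \<in> edges then f e else 0)"

lemma entry_edge_lambda: "entry (edge_lambda f) e = (if e \<in> edges then f e else 0)"
  unfolding edge_lambda_def by (subst Abs_edge_vec_inverse) auto

lemma entry_non_edge: "e \<notin> edges \<Longrightarrow> entry x e = 0"
  using entry[of x] by simp

lemma edge_vec_eqI:
  assumes "\<And>e. e \<in> edges \<Longrightarrow> entry x e = entry y e"
  shows "x = y"
proof -
  have "entry x = entry y"
    using assms entry_non_edge by (metis ext)
  then show ?thesis by (simp add: entry_inject)
qed

instantiation edge_vec :: (finite) real_inner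
begin

definition "0 = edge_lambda (\<lambda>_. 0)"
definition "x + y = edge_lambda (\<lambda>e. entry x e + entry y e)"
definition "x - y = edge_lambda (\<lambda>e. entry x e - entry y e)"
definition "- x = edge_lambda (\<lambda>e. - entry x e)"
definition "scaleR r x = edge_lambda (\<lambda>e. r * entry x e)"
definition "inner x y = (\<Sum>e\<in>edges. entry x e * entry y e)"
definition "norm (x :: 'a edge_vec) = sqrt (inner x x)"
definition "dist (x :: 'a edge_vec) y = norm (x - y)"
definition "sgn (x :: 'a edge_vec) = scaleR (inverse (norm x)) x"
definition "(uniformity :: ('a edge_vec \<times> 'a edge_vec) filter) =
  (INF e\<in>{0<..}. principal {(x, y). dist x y < e})"
definition "open (S :: 'a edge_vec set) =
  (\<forall>x\<in>S. \<forall>\<^sub>F (x', y) in uniformity. x' = x \<longrightarrow> y \<in> S)"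

instance
proof
  fix x y z :: "'a edge_vec" and r s :: real
  note ops = zero_edge_vec_def plus_edge_vec_def minus_edge_vec_def uminus_edge_vec_def
    scaleR_edge_vec_def entry_edge_lambda
  show "x + y + z = x + (y + z)" "x + y = y + x" "0 + x = x" "- x + x = 0" "x - y = x + - y"
    by (rule edge_vec_eqI; simp add: ops)+
  show "r *\<^sub>R (x + y) = r *\<^sub>R x + r *\<^sub>R y" "(r + s) *\<^sub>R x = r *\<^sub>R x + s *\<^sub>R x"
    "r *\<^sub>R s *\<^sub>R x = (r * s) *\<^sub>R x" "1 *\<^sub>R x = x"
    by (rule edge_vec_eqI; simp add: ops algebra_simps)+
  show "dist x y = norm (x - y)" "sgn x = inverse (norm x) *\<^sub>R x" "norm x = sqrt (inner x x)"
    by (fact dist_edge_vec_def sgn_edge_vec_def norm_edge_vec_def)+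
  show "(uniformity :: ('a edge_vec \<times> 'a edge_vec) filter) =
      (INF e\<in>{0<..}. principal {(x, y). dist x y < e})"
    by (fact uniformity_edge_vec_def)
  show "open S = (\<forall>x\<in>S. \<forall>\<^sub>F (x', y) in uniformity. x' = x \<longrightarrow> y \<in> S)" for S :: "'a edge_vec set"
    by (fact open_edge_vec_def)
  show "inner x y = inner y x"
    by (simp add: inner_edge_vec_def mult.commute)
  show "inner (x + y) z = inner x z + inner y z"
    by (simp add: inner_edge_vec_def ops sum.distrib algebra_simps)
  show "inner (r *\<^sub>R x) y = r * inner x y"
    by (simp add: inner_edge_vec_def ops sum_distrib_left algebra_simps)
  show "0 \<le> inner x x"
    by (simp add: inner_edge_vec_def sum_nonneg)
  show "inner x x = 0 \<longleftrightarrow> x = 0"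
  proof
    assume "inner x x = 0"
    then have "\<forall>e\<in>edges. entry x e = 0"
      unfolding inner_edge_vec_def by (subst (asm) sum_nonneg_eq_0_iff) auto
    then show "x = 0"
      by (intro edge_vec_eqI) (simp add: ops)
  qed (simp add: inner_edge_vec_def ops)
qed

end

definition edge_abs :: "'n edge_vec \<Rightarrow> 'n edge_vec" where
  "edge_abs x = edge_lambda (\<lambda>e. \<bar>entry x e\<bar>)"

definition hadamard :: "'n edge_vec \<Rightarrow> 'n edge_vec \<Rightarrow> 'n edge_vec" where
  "hadamard x y = edge_lambda (\<lambda>e. entry x e * entry y e)"

definition norm1 :: "'n::finite edge_vec \<Rightarrow> real" where
  "norm1 x = (\<Sum>e\<in>edges. \<bar>entry x e\<bar>)"

definition adjacency :: "'n::finite edge_vec \<Rightarrow> real ^ 'n ^ 'n" where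
  "adjacency x = (\<chi> i j. if i = j then 0 else entry x {i, j})"

definition diag :: "real ^ 'n \<Rightarrow> real ^ 'n ^ 'n" where
  "diag v = (\<chi> i j. if i = j then v $ i else 0)"

definition laplacian :: "'n::finite edge_vec \<Rightarrow> real ^ 'n ^ 'n" where
  "laplacian x = diag (adjacency x *v 1) - adjacency x"

definition charpoly :: "real ^ 'n ^ 'n \<Rightarrow> real poly" where
  "charpoly A = det (mat [:0, 1:] - map_matrix (\<lambda>c. [:c:]) A)"

(* Real eigenvalues, counted with (algebraic) multiplicity. *)
definition eigenvalues :: "real ^ 'n ^ 'n \<Rightarrow> real multiset" where
  "eigenvalues A = proots (charpoly A)"

(* The columns of V are orthonormal eigenvectors of A, with eigenvalues lam $ k. *)
definition orthonormal_eigensystem :: "real ^ 'n ^ 'n \<Rightarrow> real ^ 'n ^ 'n \<Rightarrow> real ^ 'n \<Rightarrow> bool" where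
  "orthonormal_eigensystem A V lam \<longleftrightarrow>
     orthogonal_matrix V \<and> (\<forall>k. A *v column k V = lam $ k *\<^sub>R column k V)"

definition is_supergradient :: "('a::real_inner \<Rightarrow> real) \<Rightarrow> 'a \<Rightarrow> 'a \<Rightarrow> bool" where
  "is_supergradient f x m \<longleftrightarrow> (\<forall>y. f y \<le> f x + m \<bullet> (y - x))"

definition is_subgradient :: "('a::real_inner \<Rightarrow> real) \<Rightarrow> 'a \<Rightarrow> 'a \<Rightarrow> bool" where
  "is_subgradient f x z \<longleftrightarrow> (\<forall>y. f y \<ge> f x + z \<bullet> (y - x))"

definition entrywise :: "(real \<Rightarrow> real) \<Rightarrow> real ^ 'm \<Rightarrow> real ^ 'm" where
  "entrywise f v = (\<chi> k. f (v $ k))"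

definition spectral_sum :: "(real \<Rightarrow> real) \<Rightarrow> 'n::finite edge_vec \<Rightarrow> real" where
  "spectral_sum g x = (\<Sum>t\<in>#eigenvalues (laplacian x). g t)"

definition fcls :: "(real \<Rightarrow> real) \<Rightarrow> 'n::finite edge_vec \<Rightarrow> real" where
  "fcls g \<beta> = 1/2 * spectral_sum g (edge_abs \<beta>)"

(* The summand is symmetric in i and j, so THE picks a well-defined value for each unordered
   pair; see entry_laplacian_coeff. *)
definition laplacian_coeff :: "real ^ 'm ^ 'n \<Rightarrow> real ^ 'm \<Rightarrow> 'n::finite edge_vec" where
  "laplacian_coeff V w = edge_lambda (\<lambda>e. THE r. \<exists>i j. e = {i, j} \<and> i \<noteq> j \<and>
     r = (\<Sum>k\<in>UNIV. w $ k * (V $ i $ k - V $ j $ k)\<^sup>2))"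

lemma entry_laplacian_coeff:
  fixes V :: "real ^ 'm ^ 'n::finite"
  assumes "i \<noteq> j"
  shows "entry (laplacian_coeff V w) {i, j} = (\<Sum>k\<in>UNIV. w $ k * (V $ i $ k - V $ j $ k)\<^sup>2)"
proof -
  have "{i, j} \<in> edges"
    using assms by (simp add: edges_def)
  moreover have "(THE r. \<exists>i' j'. {i, j} = {i', j'} \<and> i' \<noteq> j' \<and>
      r = (\<Sum>k\<in>UNIV. w $ k * (V $ i' $ k - V $ j' $ k)\<^sup>2)) =
      (\<Sum>k\<in>UNIV. w $ k * (V $ i $ k - V $ j $ k)\<^sup>2)"
    using assms by (intro the_equality) (auto simp: doubleton_eq_iff power2_commute)
  ultimately show ?thesis
    by (simp add: laplacian_coeff_def entry_edge_lambda)
qed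

(* In the following definitions V and lam choose, for every entrywise nonnegative x = |b|, an
   orthonormal eigensystem V x, lam x of laplacian x, and g' chooses super-gradients of g. *)
definition coeff_at ::
  "(real \<Rightarrow> real) \<Rightarrow> ('n edge_vec \<Rightarrow> real ^ 'n ^ 'n) \<Rightarrow> ('n edge_vec \<Rightarrow> real ^ 'n) \<Rightarrow>
   'n::finite edge_vec \<Rightarrow> 'n edge_vec" where
  "coeff_at g' V lam b = laplacian_coeff (V (edge_abs b)) (entrywise g' (lam (edge_abs b)))"

definition Q_linear ::
  "(real \<Rightarrow> real) \<Rightarrow> ('n edge_vec \<Rightarrow> real ^ 'n ^ 'n) \<Rightarrow> ('n edge_vec \<Rightarrow> real ^ 'n) \<Rightarrow>
   'n::finite edge_vec \<Rightarrow> 'n edge_vec \<Rightarrow> real" where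
  "Q_linear g' V lam \<beta> b = 1/2 * (\<Sum>e\<in>edges. entry (coeff_at g' V lam b) e * \<bar>entry \<beta> e\<bar>)"

(* Q(\<beta> | b); the terms after Q_linear g' V lam \<beta> b form const(b), for which Q(b | b) = s(b). *)
definition Q ::
  "(real \<Rightarrow> real) \<Rightarrow> (real \<Rightarrow> real) \<Rightarrow> ('n edge_vec \<Rightarrow> real ^ 'n ^ 'n) \<Rightarrow>
   ('n edge_vec \<Rightarrow> real ^ 'n) \<Rightarrow> 'n::finite edge_vec \<Rightarrow> 'n edge_vec \<Rightarrow> real" where
  "Q g g' V lam \<beta> b = Q_linear g' V lam \<beta> b + (fcls g b - Q_linear g' V lam b b)"

definition stationary_point ::
  "(real \<Rightarrow> real) \<Rightarrow> (real \<Rightarrow> real) \<Rightarrow> ('n edge_vec \<Rightarrow> real ^ 'n ^ 'n) \<Rightarrow>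
   ('n edge_vec \<Rightarrow> real ^ 'n) \<Rightarrow> ('n::finite edge_vec \<Rightarrow> real) \<Rightarrow> 'n edge_vec \<Rightarrow> bool" where
  "stationary_point g g' V lam loss \<beta> \<longleftrightarrow>
     (let m = coeff_at g' V lam \<beta> in
       is_supergradient (spectral_sum g) (edge_abs \<beta>) m \<and>
       (\<exists>grad z. GDERIV loss \<beta> :> grad \<and> is_subgradient norm1 \<beta> z \<and>
          0 = grad + (1/2) *\<^sub>R hadamard m z))"

end

theory Submission
  imports Defs
begin

text \<open>Write \<open>L(x)\<close> for the Laplacian of \<open>x\<close>. Everything rests on the fact that
  \<open>m = M(V, g'(\<lambda>))\<close>, computed from an orthonormal eigensystem \<open>(V, \<lambda>)\<close> of \<open>L(x)\<close>, is a
  super-gradient of \<open>x \<mapsto> \<Sum>\<^sub>k g(\<lambda>\<^sub>k(L(x)))\<close> at \<open>x\<close>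
  (\<open>spectral_sum_supergradient\<close>). It is proved without differentiating eigenvalues. If \<open>\<mu>\<^sub>k, u\<^sub>k\<close>
  is an eigensystem of a symmetric \<open>B\<close>, the weights \<open>p\<^sub>k\<^sub>l = (u\<^sub>k \<bullet> v\<^sub>l)\<^sup>2\<close> are doubly
  stochastic and \<open>v\<^sub>l \<bullet> B v\<^sub>l = \<Sum>\<^sub>k p\<^sub>k\<^sub>l \<mu>\<^sub>k\<close>. Averaging the scalar
  tangent inequalities \<open>g(\<mu>\<^sub>k) \<le> g(\<lambda>\<^sub>l) + g'(\<lambda>\<^sub>l) (\<mu>\<^sub>k - \<lambda>\<^sub>l)\<close> with these weights gives
  \<open>\<Sum>\<^sub>k g(\<mu>\<^sub>k) \<le> \<Sum>\<^sub>l g(\<lambda>\<^sub>l) + \<Sum>\<^sub>l g'(\<lambda>\<^sub>l) (v\<^sub>l \<bullet> B v\<^sub>l - \<lambda>\<^sub>l)\<close>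
  (\<open>spectral_supergradient_inequality\<close>). For \<open>B = L(y)\<close> the last sum is linear in \<open>y\<close>, and since
  \<open>v \<bullet> L(y) v = \<Sum>\<^bsub>{i,j}\<^esub> y\<^bsub>{i,j}\<^esub> (v\<^sub>i - v\<^sub>j)\<^sup>2\<close> its coefficients are exactly those of \<open>m\<close>
  (\<open>inner_laplacian_coeff\<close>).

  The inequality is needed for \<open>y\<close> with entries of either sign, so the spectral theorem for
  arbitrary symmetric matrices is required; it follows by repeatedly maximizing the quadratic form
  on the orthogonal complement of the eigenvectors found so far. Diagonalizing the characteristic
  polynomial then identifies its roots with the eigenvalues of an eigensystem.

  Evaluating the super-gradient inequality at absolute values gives the majorization. The
  coefficients of \<open>m\<close> are nonnegative because \<open>g\<close> is increasing, whence \<open>Q\<close> is convex. The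
  coefficient of \<open>m\<close> at \<open>{i, j}\<close> is the quadratic form of the spectral function \<open>g'(L(x))\<close> at
  \<open>e\<^sub>i - e\<^sub>j\<close>, which is independent of the eigenbasis, and at \<open>x = 0\<close> it is
  \<open>g'(0) |e\<^sub>i - e\<^sub>j|\<^sup>2 = 2 g'(0)\<close>. Finally, a minimizer of a differentiable function plus a weighted
  \<open>1\<close>-norm satisfies the first-order condition one coordinate at a time
  (\<open>weighted_norm1_minimizer\<close>).\<close>

section \<open>Orthonormal bases and symmetric matrices\<close>

lemma inner_column_column:
  fixes V :: "real ^ 'n ^ 'n"
  assumes "orthogonal_matrix V"
  shows "column k V \<bullet> column l V = (if k = l then 1 else 0)"
  using assms unfolding orthogonal_matrix_orthonormal_columns
  by (auto simp: orthogonal_def norm_eq_1)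

lemma parseval:
  fixes V :: "real ^ 'n ^ 'n"
  assumes "orthogonal_matrix V"
  shows "(\<Sum>k\<in>UNIV. (column k V \<bullet> x) * (column k V \<bullet> y)) = x \<bullet> y"
proof -
  have "orthogonal_transformation ((*v) (transpose V))"
    using assms by (simp add: orthogonal_transformation_matrix)
  then have "(transpose V *v x) \<bullet> (transpose V *v y) = x \<bullet> y"
    by (simp add: orthogonal_transformation_def)
  moreover have "(transpose V *v z) $ k = column k V \<bullet> z" for z k
    by (simp add: matrix_vector_mul_component transpose_def column_def)
  ultimately show ?thesis
    by (simp only: inner_vec_def[of "transpose V *v x"] inner_real_def)
qed

lemma symmetric_matrix_inner:
  fixes A :: "real ^ 'n ^ 'n"
  assumes "transpose A = A"
  shows "(A *v x) \<bullet> y = x \<bullet> (A *v y)"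
  using dot_lmul_matrix[of x A y] assms by (metis transpose_matrix_vector)

lemma eigensystem_quadratic_form:
  fixes A :: "real ^ 'n ^ 'n"
  assumes "orthonormal_eigensystem A V lam" "transpose A = A"
  shows "x \<bullet> (A *v x) = (\<Sum>k\<in>UNIV. (column k V \<bullet> x)\<^sup>2 * lam $ k)"
proof -
  have "orthogonal_matrix V" and eig: "A *v column k V = lam $ k *\<^sub>R column k V" for k
    using assms unfolding orthonormal_eigensystem_def by auto
  then have "x \<bullet> (A *v x) = (\<Sum>k\<in>UNIV. (column k V \<bullet> x) * (column k V \<bullet> (A *v x)))"
    by (simp add: parseval)
  also have "\<dots> = (\<Sum>k\<in>UNIV. (column k V \<bullet> x)\<^sup>2 * lam $ k)"
    by (simp add: symmetric_matrix_inner[OF assms(2), symmetric] eig power2_eq_square mult_ac)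
  finally show ?thesis .
qed

text \<open>The unit vector \<open>v\<close> maximizes \<open>x \<bullet> A x\<close> on the unit sphere of \<open>S\<close>. With \<open>c\<close> the maximum,
  \<open>q(x) = c |x|\<^sup>2 - x \<bullet> A x\<close> is nonnegative on \<open>S\<close> and vanishes at \<open>v\<close>, so its first-order term at
  \<open>v\<close> vanishes in every direction of \<open>S\<close>; invariance of \<open>S\<close> makes the residual \<open>c v - A v\<close> such a
  direction.\<close>

lemma rayleigh_eigenvector:
  fixes A :: "real ^ 'n ^ 'n"
  assumes sym: "transpose A = A" and S: "subspace S" "S \<noteq> {0}"
    and inv: "\<And>x. x \<in> S \<Longrightarrow> A *v x \<in> S"
  obtains v c where "v \<in> S" "norm v = 1" "A *v v = c *\<^sub>R v"
proof -
  let ?K = "S \<inter> sphere 0 1"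
  obtain x where "x \<in> S" "x \<noteq> 0"
    using S subspace_0 by blast
  then have "(1 / norm x) *\<^sub>R x \<in> ?K"
    using S by (simp add: subspace_scale)
  moreover have "compact ?K"
    using closed_subspace[OF S(1)] compact_sphere by (metis Int_commute compact_Int_closed)
  moreover have "continuous_on ?K (\<lambda>x. x \<bullet> (A *v x))"
    by (intro continuous_intros matrix_vector_mult_linear_continuous_on)
  ultimately obtain v where v: "v \<in> ?K"
    and max: "\<And>x. x \<in> ?K \<Longrightarrow> x \<bullet> (A *v x) \<le> v \<bullet> (A *v v)"
    using continuous_attains_sup[of ?K] by blast
  define c where "c = v \<bullet> (A *v v)"
  define q where "q x = c * (x \<bullet> x) - x \<bullet> (A *v x)" for x
  have vS: "v \<in> S" and vn: "norm v = 1"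
    using v by auto
  have q_nonneg: "q x \<ge> 0" if "x \<in> S" for x
  proof (cases "x = 0")
    case False
    let ?y = "(1 / norm x) *\<^sub>R x"
    have "?y \<in> ?K"
      using that False S by (simp add: subspace_scale)
    from max[OF this] have "(x \<bullet> (A *v x)) / (norm x)\<^sup>2 \<le> c"
      by (simp add: c_def matrix_vector_mult_scaleR power2_eq_square)
    then show ?thesis
      using False by (simp add: q_def dot_square_norm field_simps)
  qed (simp add: q_def)
  define w where "w = c *\<^sub>R v - A *v v"
  have wS: "w \<in> S"
    unfolding w_def using S vS inv by (intro subspace_diff subspace_scale) auto
  have q_line: "q (v + t *\<^sub>R w) = 2 * t * (w \<bullet> w) + t\<^sup>2 * q w" for t
  proof -
    have "q v = 0"
      using vn by (simp add: q_def c_def norm_eq_1)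
    moreover have "q (v + t *\<^sub>R w) = q v + 2 * t * (c * (w \<bullet> v) - w \<bullet> (A *v v)) + t\<^sup>2 * q w"
      unfolding q_def
      using symmetric_matrix_inner[OF sym, of v w]
      by (simp add: matrix_vector_right_distrib matrix_vector_mult_scaleR inner_add_left
          inner_add_right inner_commute algebra_simps power2_eq_square)
    moreover have "c * (w \<bullet> v) - w \<bullet> (A *v v) = w \<bullet> w"
      by (simp add: w_def inner_diff_right)
    ultimately show ?thesis by simp
  qed
  have "w = 0"
  proof (rule ccontr)
    assume "w \<noteq> 0"
    then have pos: "w \<bullet> w > 0" by simp
    have qw: "q w \<ge> 0"
      using q_nonneg wS by blast
    \<comment> \<open>For this negative step the linear term \<open>2 t |w|\<^sup>2\<close> of \<open>q\<close> outweighs \<open>t\<^sup>2 q(w)\<close>;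
      the summand \<open>1\<close> only keeps the denominator positive.\<close>
    define t where "t = - (w \<bullet> w) / (q w + 1)"
    have "t < 0"
      using pos qw by (simp add: t_def divide_neg_pos)
    have "v + t *\<^sub>R w \<in> S"
      using vS wS S by (simp add: subspace_add subspace_scale)
    then have "0 \<le> 2 * t * (w \<bullet> w) + t\<^sup>2 * q w"
      using q_nonneg q_line by metis
    then have "0 \<le> t * (2 * (w \<bullet> w) + t * q w)"
      by (simp add: algebra_simps power2_eq_square)
    then have "2 * (w \<bullet> w) + t * q w \<le> 0"
      using \<open>t < 0\<close> by (simp add: zero_le_mult_iff)
    moreover have "t * q w \<ge> - (w \<bullet> w)"
      using pos qw by (simp add: t_def field_simps)
    ultimately show False using pos by linarith
  qed
  then show ?thesis
    using that[of v c] vS vn by (simp add: w_def)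
qed

text \<open>The orthogonal complement of a set of eigenvectors of a symmetric matrix is invariant, hence
  contains a further eigenvector as long as it is not trivial.\<close>

lemma orthonormal_eigenvectors:
  fixes A :: "real ^ 'n ^ 'n"
  assumes sym: "transpose A = A" and "k \<le> CARD('n)"
  shows "\<exists>B. finite B \<and> card B = k \<and> pairwise orthogonal B \<and>
    (\<forall>v\<in>B. norm v = 1 \<and> (\<exists>c. A *v v = c *\<^sub>R v))"
  using assms(2)
proof (induction k)
  case 0
  then show ?case by (intro exI[of _ "{}"]) auto
next
  case (Suc k)
  then obtain B where B: "finite B" "card B = k" "pairwise orthogonal B"
    "\<forall>v\<in>B. norm v = 1 \<and> (\<exists>c. A *v v = c *\<^sub>R v)"
    by auto
  define S where "S = {x. \<forall>v\<in>B. v \<bullet> x = 0}"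
  have S: "subspace S"
    by (auto simp: S_def subspace_def inner_add_right)
  have "dim B < DIM(real ^ 'n)"
    using dim_le_card'[OF B(1)] B(2) Suc.prems by simp
  from orthogonal_to_subspace_exists[OF this] obtain x
    where "x \<noteq> 0" "\<And>y. y \<in> span B \<Longrightarrow> orthogonal x y" by blast
  then have "S \<noteq> {0}"
    by (auto simp: S_def orthogonal_def span_base inner_commute)
  moreover have "A *v x \<in> S" if "x \<in> S" for x
  proof -
    have "v \<bullet> (A *v x) = 0" if "v \<in> B" for v
    proof -
      obtain c where "A *v v = c *\<^sub>R v" using B(4) \<open>v \<in> B\<close> by blast
      then show ?thesis
        using \<open>x \<in> S\<close> \<open>v \<in> B\<close> symmetric_matrix_inner[OF sym, of v x] by (simp add: S_def)
    qed
    then show ?thesis by (simp add: S_def)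
  qed
  ultimately obtain v c where v: "v \<in> S" "norm v = 1" "A *v v = c *\<^sub>R v"
    using rayleigh_eigenvector[OF sym S] by blast
  have "v \<notin> B"
    using v by (auto simp: S_def)
  then have "card (insert v B) = Suc k"
    using B by simp
  moreover have "pairwise orthogonal (insert v B)"
    using B(3) v(1) by (auto simp: pairwise_insert S_def orthogonal_def inner_commute)
  ultimately show ?case
    using B v by (intro exI[of _ "insert v B"]) auto
qed

theorem spectral_theorem_symmetric:
  fixes A :: "real ^ 'n ^ 'n"
  assumes "transpose A = A"
  obtains V lam where "orthonormal_eigensystem A V lam"
proof -
  obtain B where B: "finite B" "card B = CARD('n)" "pairwise orthogonal B"
    "\<forall>v\<in>B. norm v = 1 \<and> (\<exists>c. A *v v = c *\<^sub>R v)"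
    using orthonormal_eigenvectors[OF assms, of "CARD('n)"] by auto
  obtain f :: "'n \<Rightarrow> real ^ 'n" where f: "bij_betw f UNIV B"
    using finite_same_card_bij[of "UNIV :: 'n set" B] B by auto
  then have fB: "f k \<in> B" and inj: "f k = f l \<Longrightarrow> k = l" for k l
    by (auto simp: bij_betw_def inj_on_def)
  define V :: "real ^ 'n ^ 'n" where "V = (\<chi> i k. f k $ i)"
  have col: "column k V = f k" for k
    by (simp add: V_def column_def)
  have "\<forall>k. \<exists>c. A *v f k = c *\<^sub>R f k"
    using B(4) fB by blast
  then obtain c where c: "\<And>k. A *v f k = c k *\<^sub>R f k"
    by metis
  have "orthogonal_matrix V"
    unfolding orthogonal_matrix_orthonormal_columns col
  proof (intro conjI allI impI)
    show "norm (f k) = 1" for k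
      using B(4) fB by blast
    show "orthogonal (f k) (f l)" if "k \<noteq> l" for k l
      using B(3) fB inj that by (meson pairwiseD)
  qed
  then have "orthonormal_eigensystem A V (\<chi> k. c k)"
    by (simp add: orthonormal_eigensystem_def col c)
  then show ?thesis by (rule that)
qed

section \<open>The characteristic polynomial of a diagonalized matrix\<close>

lemma map_matrix_const_poly_mult:
  fixes A B :: "real ^ 'n ^ 'n"
  shows "map_matrix (\<lambda>c. [:c:]) (A ** B) = map_matrix (\<lambda>c. [:c:]) A ** map_matrix (\<lambda>c. [:c:]) B"
proof -
  have "[:\<Sum>k\<in>S. f k:] = (\<Sum>k\<in>S. [:f k:])" for f :: "'n \<Rightarrow> real" and S
  proof (induction S rule: infinite_finite_induct)
    case (insert k S)
    show ?case
      using insert.hyps by (simp flip: insert.IH)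
  qed auto
  then show ?thesis
    by (simp add: vec_eq_iff matrix_matrix_mult_def mult.commute)
qed

text \<open>From \<open>A V = V L\<close> with \<open>L\<close> diagonal, \<open>(X - A) V = V (X - L)\<close> over the polynomial ring.
  The determinant of \<open>V\<close> is a unit and cancels, which leaves \<open>\<Prod>\<^sub>k (X - \<lambda>\<^sub>k)\<close>.\<close>

lemma eigenvalues_eigensystem:
  fixes A :: "real ^ 'n ^ 'n"
  assumes "orthonormal_eigensystem A V lam"
  shows "eigenvalues A = image_mset (($) lam) (mset_set UNIV)"
proof -
  let ?C = "map_matrix (\<lambda>c. [:c:]) :: real ^ 'n ^ 'n \<Rightarrow> real poly ^ 'n ^ 'n"
  let ?X = "mat [:0, 1:] :: real poly ^ 'n ^ 'n"
  define L where "L = diag lam"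
  have V: "orthogonal_matrix V"
    and eig: "A *v column k V = lam $ k *\<^sub>R column k V" for k
    using assms unfolding orthonormal_eigensystem_def by auto
  have AV: "A ** V = V ** L"
  proof -
    have "(A ** V) $ i $ k = (V ** L) $ i $ k" for i k
    proof -
      have "(A ** V) $ i $ k = (A *v column k V) $ i"
        by (simp add: matrix_matrix_mult_def matrix_vector_mult_def column_def)
      also have "\<dots> = lam $ k * V $ i $ k"
        by (simp only: eig) (simp add: column_def)
      also have "\<dots> = (V ** L) $ i $ k"
        by (simp add: matrix_matrix_mult_def L_def diag_def if_distrib cong: if_cong)
      finally show ?thesis .
    qed
    then show ?thesis by (simp add: vec_eq_iff)
  qed
  have comm: "?X ** M = M ** ?X" for M
    by (simp add: vec_eq_iff matrix_matrix_mult_def mat_def if_distrib if_distribR mult.commute cong: if_cong)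
  have distrib: "(M - N) ** K = M ** K - N ** K" "K ** (M - N) = K ** M - K ** N"
    for K M N :: "real poly ^ 'n ^ 'n"
    by (simp_all add: vec_eq_iff matrix_matrix_mult_def left_diff_distrib right_diff_distrib
        sum_subtractf)
  have "(?X - ?C A) ** ?C V = ?C V ** (?X - ?C L)"
    using arg_cong[OF AV, of ?C]
    by (simp add: map_matrix_const_poly_mult comm distrib)
  then have "det (?X - ?C A) * det (?C V) = det (?C V) * det (?X - ?C L)"
    by (metis det_mul)
  moreover have "det (?C V) \<noteq> 0"
  proof -
    have "?C (transpose V) ** ?C V = ?C (mat 1)"
      using V by (simp add: orthogonal_matrix flip: map_matrix_const_poly_mult)
    moreover have "?C (mat 1) = mat 1"
      by (simp add: vec_eq_iff mat_def)
    ultimately have "det (?C (transpose V)) * det (?C V) = 1"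
      by (metis det_mul det_I)
    then show ?thesis by auto
  qed
  ultimately have "charpoly A = det (?X - ?C L)"
    by (simp add: charpoly_def)
  also have "\<dots> = (\<Prod>k\<in>UNIV. [:- lam $ k, 1:])"
    by (subst det_diagonal) (auto simp: L_def diag_def mat_def)
  finally have "eigenvalues A = (\<Sum>k\<in>UNIV. {#lam $ k#})"
    by (simp add: eigenvalues_def proots_prod)
  moreover have "(\<Sum>k\<in>S. {#lam $ k#}) = image_mset (($) lam) (mset_set S)" if "finite S" for S
    using that by induction auto
  ultimately show ?thesis by simp
qed

section \<open>Super-gradients of spectral sums\<close>

text \<open>The squared inner products of two orthonormal bases form a doubly stochastic matrix: its row
  sums distribute \<open>g(\<mu>\<^sub>k)\<close> over \<open>l\<close>, its column sums recollect the tangents at \<open>\<lambda>\<^sub>l\<close>.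
  The inequality is an equality when \<open>lam\<close> and \<open>V\<close> diagonalize \<open>B\<close>.\<close>

lemma spectral_supergradient_inequality:
  fixes B V :: "real ^ 'n ^ 'n"
  assumes g: "\<And>t. is_supergradient g t (g' t)"
    and U: "orthonormal_eigensystem B U \<mu>" and sym: "transpose B = B"
    and V: "orthogonal_matrix V"
  shows "(\<Sum>k\<in>UNIV. g (\<mu> $ k)) \<le>
    (\<Sum>l\<in>UNIV. g (lam l) + g' (lam l) * (column l V \<bullet> (B *v column l V) - lam l))"
proof -
  define p where "p k l = (column k U \<bullet> column l V)\<^sup>2" for k l
  have oU: "orthogonal_matrix U"
    using U by (simp add: orthonormal_eigensystem_def)
  have row: "(\<Sum>l\<in>UNIV. p k l) = 1" for k
    using parseval[OF V, of "column k U" "column k U"]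
    by (simp add: p_def power2_eq_square inner_commute inner_column_column[OF oU])
  have col: "(\<Sum>k\<in>UNIV. p k l) = 1" for l
    using parseval[OF oU, of "column l V" "column l V"]
    by (simp add: p_def power2_eq_square inner_column_column[OF V])
  have quad: "column l V \<bullet> (B *v column l V) = (\<Sum>k\<in>UNIV. p k l * \<mu> $ k)" for l
    unfolding p_def by (rule eigensystem_quadratic_form[OF U sym])
  have mean: "(\<Sum>k\<in>UNIV. p k l * a + c * (p k l * \<mu> $ k)) =
      a + c * (column l V \<bullet> (B *v column l V))" for l a c
    by (simp add: quad sum.distrib col flip: sum_distrib_right sum_distrib_left)
  have tangent: "g s \<le> g t + g' t * (s - t)" for s t
    using g by (simp add: is_supergradient_def)
  have "(\<Sum>k\<in>UNIV. g (\<mu> $ k)) = (\<Sum>k\<in>UNIV. \<Sum>l\<in>UNIV. p k l * g (\<mu> $ k))"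
    by (simp add: row flip: sum_distrib_right)
  also have "\<dots> \<le> (\<Sum>k\<in>UNIV. \<Sum>l\<in>UNIV. p k l * (g (lam l) + g' (lam l) * (\<mu> $ k - lam l)))"
    by (intro sum_mono mult_left_mono tangent) (simp add: p_def)
  also have "\<dots> = (\<Sum>l\<in>UNIV. \<Sum>k\<in>UNIV.
      p k l * (g (lam l) - g' (lam l) * lam l) + g' (lam l) * (p k l * \<mu> $ k))"
    by (subst sum.swap) (simp add: algebra_simps)
  also have "\<dots> = (\<Sum>l\<in>UNIV. g (lam l) + g' (lam l) * (column l V \<bullet> (B *v column l V) - lam l))"
    by (simp only: mean) (simp add: algebra_simps)
  finally show ?thesis .
qed

text \<open>Both sides are \<open>x \<bullet> f(A) x\<close> for the spectral function \<open>f(A)\<close>. Eigenvectors of the two systems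
  that are not orthogonal belong to the same eigenvalue, so in the double expansion the weight
  \<open>f(\<mu>\<^sub>k)\<close> may be exchanged for \<open>f(\<mu>'\<^sub>l)\<close>.\<close>

lemma weighted_projections_unique:
  fixes A :: "real ^ 'n ^ 'n"
  assumes U: "orthonormal_eigensystem A U \<mu>" and U': "orthonormal_eigensystem A U' \<mu>'"
    and sym: "transpose A = A"
  shows "(\<Sum>k\<in>UNIV. f (\<mu> $ k) * (column k U \<bullet> x)\<^sup>2) =
    (\<Sum>l\<in>UNIV. f (\<mu>' $ l) * (column l U' \<bullet> x)\<^sup>2)"
proof -
  let ?u = "\<lambda>k. column k U" and ?v = "\<lambda>l. column l U'"
  have o: "orthogonal_matrix U" "orthogonal_matrix U'"
    and eig: "A *v ?u k = \<mu> $ k *\<^sub>R ?u k" "A *v ?v k = \<mu>' $ k *\<^sub>R ?v k" for k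
    using U U' unfolding orthonormal_eigensystem_def by auto
  have cross: "f (\<mu> $ k) * (?u k \<bullet> ?v l) = f (\<mu>' $ l) * (?u k \<bullet> ?v l)" for k l
    using symmetric_matrix_inner[OF sym, of "?u k" "?v l"] by (auto simp: eig)
  have "(\<Sum>k\<in>UNIV. f (\<mu> $ k) * (?u k \<bullet> x)\<^sup>2) =
      (\<Sum>k\<in>UNIV. f (\<mu> $ k) * (?u k \<bullet> x) * (\<Sum>l\<in>UNIV. (?v l \<bullet> ?u k) * (?v l \<bullet> x)))"
    by (simp add: parseval[OF o(2)] power2_eq_square mult.assoc)
  also have "\<dots> = (\<Sum>k\<in>UNIV. \<Sum>l\<in>UNIV. f (\<mu> $ k) * (?u k \<bullet> ?v l) * ((?u k \<bullet> x) * (?v l \<bullet> x)))"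
    by (simp add: sum_distrib_left inner_commute mult_ac)
  also have "\<dots> = (\<Sum>l\<in>UNIV. \<Sum>k\<in>UNIV. f (\<mu>' $ l) * (?v l \<bullet> x) * ((?u k \<bullet> ?v l) * (?u k \<bullet> x)))"
    by (subst sum.swap) (simp add: cross mult_ac)
  also have "\<dots> = (\<Sum>l\<in>UNIV. f (\<mu>' $ l) * (?v l \<bullet> x)\<^sup>2)"
    by (simp add: parseval[OF o(1)] power2_eq_square mult.assoc flip: sum_distrib_left)
  finally show ?thesis .
qed

section \<open>Edge vectors and their Laplacians\<close>

lemma edgesE:
  assumes "e \<in> edges"
  obtains i j where "i \<noteq> j" "e = {i, j}"
  using assms by (auto simp: edges_def card_2_iff)

text \<open>Each edge arises from exactly two ordered pairs. This turns sums over edges into matrix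
  sums.\<close>

lemma sum_pairs_eq_sum_edges:
  fixes h :: "'n::finite set \<Rightarrow> real"
  shows "(\<Sum>i\<in>UNIV. \<Sum>j\<in>UNIV. if i = j then 0 else h {i, j}) = 2 * (\<Sum>e\<in>edges. h e)"
proof -
  define P where "P = {p :: 'n \<times> 'n. fst p \<noteq> snd p}"
  let ?s = "\<lambda>p :: 'n \<times> 'n. {fst p, snd p}"
  have "(\<Sum>i\<in>UNIV. \<Sum>j\<in>UNIV. if i = j then 0 else h {i, j}) =
      (\<Sum>p\<in>UNIV. if p \<in> P then h (?s p) else 0)"
    by (auto simp: sum.cartesian_product P_def intro!: sum.cong)
  also have "\<dots> = (\<Sum>p\<in>P. h (?s p))"
    by (simp add: sum.If_cases)
  also have "\<dots> = (\<Sum>e\<in>edges. \<Sum>p\<in>{p\<in>P. ?s p = e}. h (?s p))"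
    by (rule sum.group[symmetric]) (auto simp: P_def edges_def)
  also have "\<dots> = (\<Sum>e\<in>edges. 2 * h e)"
  proof (rule sum.cong[OF refl])
    fix e :: "'n set" assume "e \<in> edges"
    then obtain i j where ij: "i \<noteq> j" "e = {i, j}" by (rule edgesE)
    then have "{p\<in>P. ?s p = e} = {(i, j), (j, i)}"
      by (auto simp: P_def doubleton_eq_iff)
    then show "(\<Sum>p\<in>{p\<in>P. ?s p = e}. h (?s p)) = 2 * h e"
      using ij by (simp add: insert_commute)
  qed
  finally show ?thesis by (simp add: sum_distrib_left)
qed

lemma entry_simps:
  "entry (0 :: 'n::finite edge_vec) e = 0"
  "entry (x + y) e = entry x e + entry (y :: 'n edge_vec) e"
  "entry (x - y) e = entry x e - entry (y :: 'n edge_vec) e"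
  "entry (r *\<^sub>R x) e = r * entry (x :: 'n edge_vec) e"
  by (auto simp: zero_edge_vec_def plus_edge_vec_def minus_edge_vec_def scaleR_edge_vec_def
      entry_edge_lambda entry_non_edge)

lemma entry_edge_abs: "entry (edge_abs x) e = \<bar>entry x e\<bar>"
  by (simp add: edge_abs_def entry_edge_lambda entry_non_edge)

lemma transpose_laplacian: "transpose (laplacian x) = laplacian x"
  by (auto simp: vec_eq_iff transpose_def laplacian_def diag_def adjacency_def insert_commute)

text \<open>The Dirichlet form. The asymmetric expansion \<open>\<Sum> a\<^sub>i\<^sub>j v\<^sub>i (v\<^sub>i - v\<^sub>j)\<close> is averaged with its copy
  under the exchange of \<open>i\<close> and \<open>j\<close>.\<close>

lemma laplacian_quadratic_form:
  "v \<bullet> (laplacian x *v v) =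
    1/2 * (\<Sum>i\<in>UNIV. \<Sum>j\<in>UNIV. adjacency x $ i $ j * (v $ i - v $ j)\<^sup>2)"
proof -
  let ?a = "\<lambda>i j. adjacency x $ i $ j"
  have sym: "?a i j = ?a j i" for i j
    by (simp add: adjacency_def insert_commute)
  have "(laplacian x *v v) $ i = (\<Sum>j\<in>UNIV. ?a i j * (v $ i - v $ j))" for i
    by (simp add: laplacian_def matrix_vector_mult_diff_rdistrib diag_def matrix_vector_mult_def
        mult_delta_left sum_subtractf sum_distrib_right left_diff_distrib
        right_diff_distrib cong: if_cong)
  then have form: "v \<bullet> (laplacian x *v v) =
      (\<Sum>i\<in>UNIV. \<Sum>j\<in>UNIV. ?a i j * (v $ i * (v $ i - v $ j)))"
    by (simp add: inner_vec_def sum_distrib_left mult_ac)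
  have swapped: "(\<Sum>i\<in>UNIV. \<Sum>j\<in>UNIV. ?a i j * (v $ i * (v $ i - v $ j))) =
      (\<Sum>i\<in>UNIV. \<Sum>j\<in>UNIV. ?a i j * (v $ j * (v $ j - v $ i)))"
    by (subst sum.swap) (metis (no_types, lifting) sym sum.cong)
  have "2 * (v \<bullet> (laplacian x *v v)) = (\<Sum>i\<in>UNIV. \<Sum>j\<in>UNIV. ?a i j * (v $ i * (v $ i - v $ j)))
      + (\<Sum>i\<in>UNIV. \<Sum>j\<in>UNIV. ?a i j * (v $ j * (v $ j - v $ i)))"
    using form swapped by simp
  also have "\<dots> = (\<Sum>i\<in>UNIV. \<Sum>j\<in>UNIV. ?a i j * (v $ i - v $ j)\<^sup>2)"
    by (simp add: power2_eq_square algebra_simps flip: sum.distrib)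
  finally show ?thesis by simp
qed

text \<open>As a map of \<open>w\<close> to edge vectors, \<open>laplacian_coeff V w\<close> is adjoint to taking the diagonal of
  \<open>V\<^sup>T L(x) V\<close>. This is why it carries tangent slopes at eigenvalues to a super-gradient on edge
  vectors.\<close>

lemma inner_laplacian_coeff:
  fixes V :: "real ^ 'm ^ 'n::finite"
  shows "laplacian_coeff V w \<bullet> x =
    (\<Sum>k\<in>UNIV. w $ k * (column k V \<bullet> (laplacian x *v column k V)))"
proof -
  let ?M = "laplacian_coeff V w"
  let ?d = "\<lambda>k i j. adjacency x $ i $ j * (V $ i $ k - V $ j $ k)\<^sup>2"
  have "2 * (?M \<bullet> x) = (\<Sum>i\<in>UNIV. \<Sum>j\<in>UNIV. if i = j then 0 else entry ?M {i, j} * entry x {i, j})"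
    unfolding inner_edge_vec_def by (rule sum_pairs_eq_sum_edges[symmetric])
  also have "\<dots> = (\<Sum>i\<in>UNIV. \<Sum>j\<in>UNIV. \<Sum>k\<in>UNIV. w $ k * ?d k i j)"
    by (intro sum.cong refl)
      (simp add: entry_laplacian_coeff adjacency_def sum_distrib_left sum_distrib_right mult_ac)
  also have "\<dots> = (\<Sum>k\<in>UNIV. \<Sum>i\<in>UNIV. \<Sum>j\<in>UNIV. w $ k * ?d k i j)"
    by (subst (2) sum.swap, subst sum.swap) simp
  also have "\<dots> = 2 * (\<Sum>k\<in>UNIV. w $ k * (column k V \<bullet> (laplacian x *v column k V)))"
    by (simp add: laplacian_quadratic_form column_def sum_distrib_left mult_ac)
  finally show ?thesis by simp
qed

lemma laplacian_coeff_nonneg: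
  fixes V :: "real ^ 'm ^ 'n::finite"
  assumes "\<And>k. w $ k \<ge> 0"
  shows "entry (laplacian_coeff V w) e \<ge> 0"
proof (cases "e \<in> edges")
  case True
  then obtain i j where "i \<noteq> j" "e = {i, j}" by (rule edgesE)
  then show ?thesis
    using assms by (simp add: entry_laplacian_coeff sum_nonneg)
qed (simp add: entry_non_edge)

text \<open>The entry at \<open>{i, j}\<close> is a weighted sum of squared projections of \<open>e\<^sub>i - e\<^sub>j\<close> onto the
  eigenvectors.\<close>

lemma laplacian_coeff_eigensystem_unique:
  fixes x :: "'n::finite edge_vec"
  assumes "orthonormal_eigensystem (laplacian x) U \<mu>"
    and "orthonormal_eigensystem (laplacian x) U' \<mu>'"
  shows "laplacian_coeff U (entrywise f \<mu>) = laplacian_coeff U' (entrywise f \<mu>')"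
proof (rule edge_vec_eqI)
  fix e :: "'n set" assume "e \<in> edges"
  then obtain i j where ij: "i \<noteq> j" "e = {i, j}" by (rule edgesE)
  have "column k W \<bullet> (axis i 1 - axis j 1) = W $ i $ k - W $ j $ k"
    for W :: "real ^ 'n ^ 'n" and k
    by (simp add: inner_diff_right inner_axis column_def)
  then show "entry (laplacian_coeff U (entrywise f \<mu>)) e =
      entry (laplacian_coeff U' (entrywise f \<mu>')) e"
    using weighted_projections_unique[OF assms transpose_laplacian, of f "axis i 1 - axis j 1"] ij
    by (simp add: entry_laplacian_coeff entrywise_def)
qed

lemma spectral_sum_eigensystem:
  assumes "orthonormal_eigensystem (laplacian x) V lam"
  shows "spectral_sum g x = (\<Sum>k\<in>UNIV. g (lam $ k))"
  by (simp add: spectral_sum_def eigenvalues_eigensystem[OF assms] sum_unfold_sum_mset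
      image_mset.compositionality comp_def)

text \<open>The eigensystem is given at \<open>x\<close> only. At the comparison point \<open>y\<close>, where \<open>L(y)\<close> may be
  indefinite, one is supplied by the spectral theorem.\<close>

lemma spectral_sum_supergradient:
  assumes g: "\<And>t. is_supergradient g t (g' t)"
    and V: "orthonormal_eigensystem (laplacian x) V lam"
  shows "is_supergradient (spectral_sum g) x (laplacian_coeff V (entrywise g' lam))"
  unfolding is_supergradient_def
proof
  fix y :: "'a edge_vec"
  let ?v = "\<lambda>k. column k V"
  have o: "orthogonal_matrix V" and eig: "laplacian x *v ?v k = lam $ k *\<^sub>R ?v k" for k
    using V unfolding orthonormal_eigensystem_def by auto
  obtain U \<mu> where U: "orthonormal_eigensystem (laplacian y) U \<mu>"
    using spectral_theorem_symmetric[OF transpose_laplacian] .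
  have "spectral_sum g y \<le>
      (\<Sum>l\<in>UNIV. g (lam $ l) + g' (lam $ l) * (?v l \<bullet> (laplacian y *v ?v l) - lam $ l))"
    using spectral_supergradient_inequality[OF g U transpose_laplacian o, of "($) lam"]
    by (simp add: spectral_sum_eigensystem[OF U])
  also have "\<dots> = spectral_sum g x + laplacian_coeff V (entrywise g' lam) \<bullet> (y - x)"
    by (simp add: spectral_sum_eigensystem[OF V] inner_diff_right inner_laplacian_coeff
        entrywise_def eig inner_column_column[OF o] sum.distrib sum_subtractf algebra_simps)
  finally show "spectral_sum g y \<le>
      spectral_sum g x + laplacian_coeff V (entrywise g' lam) \<bullet> (y - x)" .
qed

section \<open>First-order conditions for weighted absolute values\<close>

lemma norm1_subgradientI:
  assumes "\<And>e. e \<in> edges \<Longrightarrow> \<bar>entry z e\<bar> \<le> 1"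
    and "\<And>e. e \<in> edges \<Longrightarrow> entry z e * entry x e = \<bar>entry x e\<bar>"
  shows "is_subgradient norm1 x z"
  unfolding is_subgradient_def
proof
  fix y
  have "entry z e * entry y e \<le> \<bar>entry y e\<bar>" if "e \<in> edges" for e
    using mult_right_mono[OF assms(1)[OF that], of "\<bar>entry y e\<bar>"]
    by (simp flip: abs_mult)
  then show "norm1 x + z \<bullet> (y - x) \<le> norm1 y"
    by (auto simp: norm1_def inner_edge_vec_def entry_simps assms(2) right_diff_distrib
        sum_subtractf intro: sum_mono)
qed

text \<open>The conditions \<open>|z| \<le> 1\<close> and \<open>z a = |a|\<close> say that \<open>z\<close> is a subgradient of the absolute
  value at \<open>a\<close>. Away from the kink this is Fermat's rule. At the kink, a slope \<open>D\<close> of modulus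
  greater than \<open>c\<close> would allow a descent to one of the two sides.\<close>

lemma weighted_abs_minimum:
  fixes f :: "real \<Rightarrow> real"
  assumes der: "(f has_real_derivative D) (at 0)" and c: "c \<ge> 0"
    and min: "\<And>t. f 0 + c * \<bar>a\<bar> \<le> f t + c * \<bar>a + t\<bar>"
  obtains z where "\<bar>z\<bar> \<le> 1" "z * a = \<bar>a\<bar>" "D + c * z = 0"
proof (cases "a = 0")
  case False
  have "((\<lambda>t. \<bar>a + t\<bar>) has_real_derivative sgn a) (at 0)"
  proof (rule has_field_derivative_transform_within)
    show "((\<lambda>t. sgn a * (a + t)) has_real_derivative sgn a) (at 0)"
      by (auto intro!: derivative_eq_intros)
    show "sgn a * (a + t) = \<bar>a + t\<bar>" if "dist t 0 < \<bar>a\<bar>" for t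
      using that False by (cases "a > 0") (auto simp: sgn_if)
  qed (use False in auto)
  then have "((\<lambda>t. f t + c * \<bar>a + t\<bar>) has_real_derivative D + c * sgn a) (at 0)"
    using der by (auto intro!: derivative_eq_intros)
  then have "D + c * sgn a = 0"
    by (rule DERIV_local_min[where d = 1]) (use min in auto)
  then show ?thesis
    using that[of "sgn a"] by (simp add: abs_sgn mult.commute abs_sgn_eq)
next
  case True
  have "D \<ge> - c"
  proof (rule ccontr)
    assume "\<not> D \<ge> - c"
    moreover have "((\<lambda>t. f t + c * t) has_real_derivative D + c) (at 0)"
      using der by (auto intro!: derivative_eq_intros)
    ultimately obtain d where d: "d > 0" "\<And>h. 0 < h \<Longrightarrow> h < d \<Longrightarrow> f (0 + h) + c * (0 + h) < f 0 + c * 0"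
      using DERIV_neg_dec_right[of "\<lambda>t. f t + c * t" "D + c" 0] by force
    show False
      using d(2)[of "d / 2"] d(1) min[of "d / 2"] True by simp
  qed
  moreover have "D \<le> c"
  proof (rule ccontr)
    assume "\<not> D \<le> c"
    moreover have "((\<lambda>t. f t - c * t) has_real_derivative D - c) (at 0)"
      using der by (auto intro!: derivative_eq_intros)
    ultimately obtain d where d: "d > 0" "\<And>h. 0 < h \<Longrightarrow> h < d \<Longrightarrow> f (0 - h) - c * (0 - h) < f 0 - c * 0"
      using DERIV_pos_inc_left[of "\<lambda>t. f t - c * t" "D - c" 0] by force
    show False
      using d(2)[of "d / 2"] d(1) min[of "- d / 2"] True by simp
  qed
  ultimately have "\<bar>D\<bar> \<le> c" by simp
  \<comment> \<open>If \<open>c = 0\<close> then \<open>D = 0\<close>, and the quotient is \<open>0\<close> by the convention for division by zero.\<close>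
  then show ?thesis
    using that[of "- D / c"] c True by (cases "c = 0") auto
qed

definition edge_unit :: "'n set \<Rightarrow> 'n::finite edge_vec" where
  "edge_unit e = edge_lambda (\<lambda>e'. if e' = e then 1 else 0)"

lemma edge_vec_expansion:
  fixes x :: "'n::finite edge_vec"
  shows "(\<Sum>e\<in>edges. entry x e *\<^sub>R edge_unit e) = x"
proof (rule edge_vec_eqI)
  fix e :: "'n set" assume e: "e \<in> edges"
  have "entry (\<Sum>e\<in>S. f e) e' = (\<Sum>e\<in>S. entry (f e) e')"
    for f :: "'n set \<Rightarrow> 'n edge_vec" and S e'
    by (induction S rule: infinite_finite_induct) (auto simp: entry_simps)
  then show "entry (\<Sum>e\<in>edges. entry x e *\<^sub>R edge_unit e) e = entry x e"
    using e by (simp add: entry_simps edge_unit_def entry_edge_lambda if_distrib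
        if_distribR cong: if_cong)
qed

text \<open>Riesz representation of the derivative in the standard basis.\<close>

lemma differentiable_edge_vec_gradient:
  fixes f :: "'n::finite edge_vec \<Rightarrow> real"
  assumes "f differentiable (at x)"
  obtains grad where "GDERIV f x :> grad"
proof -
  obtain f' where f': "(f has_derivative f') (at x)"
    using assms by (auto simp: differentiable_def)
  interpret bounded_linear f'
    using f' by (rule has_derivative_bounded_linear)
  define grad where "grad = edge_lambda (\<lambda>e. f' (edge_unit e))"
  have "f' h = h \<bullet> grad" for h
    using arg_cong[OF edge_vec_expansion[of h], of f']
    by (simp add: sum scaleR inner_edge_vec_def grad_def entry_edge_lambda)
  then have "f' = (\<lambda>h. h \<bullet> grad)" by auto
  then show ?thesis
    using f' that by (simp add: gderiv_def)
qed

text \<open>Since the penalty is separable, restricting to the line through \<open>\<beta>\<close> along each coordinate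
  direction leaves a scalar problem, whose multiplier is the entry of \<open>z\<close>.\<close>

lemma weighted_norm1_minimizer:
  fixes f :: "'n::finite edge_vec \<Rightarrow> real"
  assumes grad: "GDERIV f \<beta> :> grad" and m: "\<And>e. entry m e \<ge> 0"
    and min: "\<And>x. f \<beta> + m \<bullet> edge_abs \<beta> \<le> f x + m \<bullet> edge_abs x"
  obtains z where "is_subgradient norm1 \<beta> z" "grad + hadamard m z = 0"
proof -
  have "\<exists>z. \<bar>z\<bar> \<le> 1 \<and> z * entry \<beta> e = \<bar>entry \<beta> e\<bar> \<and> entry grad e + entry m e * z = 0"
    if e: "e \<in> edges" for e
  proof -
    let ?x = "\<lambda>t. \<beta> + t *\<^sub>R edge_unit e"
    have "edge_unit e \<bullet> grad = entry grad e"
      using e by (simp add: inner_edge_vec_def edge_unit_def entry_edge_lambda if_distrib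
          if_distribR cong: if_cong)
    moreover have "(?x has_derivative (\<lambda>t. t *\<^sub>R edge_unit e)) (at 0)"
      by (auto intro!: derivative_eq_intros)
    moreover have "(f has_derivative (\<lambda>h. h \<bullet> grad)) (at (?x 0))"
      using grad by (simp add: gderiv_def)
    ultimately have "((\<lambda>t. f (?x t)) has_real_derivative entry grad e) (at 0)"
      using has_derivative_compose[of ?x "\<lambda>t. t *\<^sub>R edge_unit e" 0 UNIV f "\<lambda>h. h \<bullet> grad"]
      by (simp add: has_field_derivative_def mult_commute_abs)
    moreover have "f (?x 0) + entry m e * \<bar>entry \<beta> e\<bar> \<le> f (?x t) + entry m e * \<bar>entry \<beta> e + t\<bar>" for t
    proof -
      let ?r = "\<Sum>e'\<in>edges - {e}. entry m e' * \<bar>entry \<beta> e'\<bar>"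
      have "m \<bullet> edge_abs (?x t) = entry m e * \<bar>entry \<beta> e + t\<bar> + ?r" for t
        using e by (simp add: inner_edge_vec_def entry_edge_abs entry_simps edge_unit_def
            entry_edge_lambda sum.remove[of edges e])
      from this[of t] this[of 0] show ?thesis
        using min[of "?x t"] by simp
    qed
    ultimately show ?thesis
      using m weighted_abs_minimum[of "\<lambda>t. f (?x t)"] by metis
  qed
  then obtain z where z: "\<And>e. e \<in> edges \<Longrightarrow> \<bar>z e\<bar> \<le> 1"
    "\<And>e. e \<in> edges \<Longrightarrow> z e * entry \<beta> e = \<bar>entry \<beta> e\<bar>"
    "\<And>e. e \<in> edges \<Longrightarrow> entry grad e + entry m e * z e = 0"
    by metis
  show ?thesis
  proof (rule that)
    show "is_subgradient norm1 \<beta> (edge_lambda z)"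
      by (rule norm1_subgradientI) (auto simp: entry_edge_lambda z)
    show "grad + hadamard m (edge_lambda z) = 0"
      by (rule edge_vec_eqI) (simp add: entry_simps hadamard_def entry_edge_lambda z)
  qed
qed

section \<open>The majorizer of the penalty\<close>

lemma supergradient_mono_nonneg:
  assumes "mono g" "is_supergradient g t s"
  shows "s \<ge> (0::real)"
proof -
  have "g t \<le> g (t + 1)"
    using assms(1) by (simp add: monoD)
  also have "\<dots> \<le> g t + s"
    using assms(2) by (auto simp: is_supergradient_def dest: spec[of _ "t + 1"])
  finally show ?thesis by simp
qed

lemma Q_linear_eq_inner: "Q_linear g' V lam \<beta> b = 1/2 * (coeff_at g' V lam b \<bullet> edge_abs \<beta>)"
  by (simp add: Q_linear_def inner_edge_vec_def entry_edge_abs)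

lemma convex_on_weighted_abs_sum:
  fixes m :: "'n::finite edge_vec"
  assumes "\<And>e. entry m e \<ge> 0"
  shows "convex_on UNIV (\<lambda>x. m \<bullet> edge_abs x)"
proof (rule convex_onI)
  fix t :: real and x y :: "'n edge_vec"
  assume t: "0 < t" "t < 1"
  have "entry m e * \<bar>(1 - t) * entry x e + t * entry y e\<bar> \<le>
      (1 - t) * (entry m e * \<bar>entry x e\<bar>) + t * (entry m e * \<bar>entry y e\<bar>)" for e
  proof -
    have "\<bar>(1 - t) * entry x e + t * entry y e\<bar> \<le> (1 - t) * \<bar>entry x e\<bar> + t * \<bar>entry y e\<bar>"
      using t abs_triangle_ineq[of "(1 - t) * entry x e" "t * entry y e"] by (simp add: abs_mult)
    from mult_left_mono[OF this assms[of e]] show ?thesis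
      by (simp add: algebra_simps)
  qed
  then show "m \<bullet> edge_abs ((1 - t) *\<^sub>R x + t *\<^sub>R y) \<le>
      (1 - t) * (m \<bullet> edge_abs x) + t * (m \<bullet> edge_abs y)"
    by (simp add: inner_edge_vec_def entry_edge_abs entry_simps sum_distrib_left
        flip: sum.distrib) (rule sum_mono, simp)
qed simp

text \<open>All eigenvalues of \<open>L(0) = 0\<close> vanish, so by Parseval the entry at \<open>{i, j}\<close> is
  \<open>g'(0) |e\<^sub>i - e\<^sub>j|\<^sup>2\<close>.\<close>

lemma coeff_at_zero:
  fixes V :: "'n::finite edge_vec \<Rightarrow> real ^ 'n ^ 'n"
  assumes "orthonormal_eigensystem (laplacian (edge_abs 0)) (V (edge_abs 0)) (lam (edge_abs 0))"
    and "e \<in> edges"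
  shows "entry (coeff_at g' V lam 0) e = 2 * g' 0"
proof -
  let ?V = "V (edge_abs 0)" and ?lam = "lam (edge_abs 0)"
  have lap: "laplacian (edge_abs 0 :: 'n edge_vec) = 0"
  proof -
    have "adjacency (edge_abs 0 :: 'n edge_vec) = 0"
      by (auto simp: vec_eq_iff adjacency_def entry_edge_abs entry_simps)
    then show ?thesis
      by (simp add: laplacian_def) (simp add: vec_eq_iff diag_def)
  qed
  have o: "orthogonal_matrix ?V" and "0 *v column k ?V = ?lam $ k *\<^sub>R column k ?V" for k
    using assms(1) unfolding orthonormal_eigensystem_def lap by auto
  then have "?lam $ k *\<^sub>R column k ?V = 0" for k
    by (metis matrix_vector_mult_0)
  moreover have "column k ?V \<noteq> 0" for k
    using inner_column_column[OF o, of k k] by auto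
  ultimately have lam: "?lam $ k = 0" for k
    by (metis scaleR_eq_0_iff)
  obtain i j where ij: "i \<noteq> j" "e = {i, j}"
    using assms(2) by (rule edgesE)
  define d where "d = (axis i 1 - axis j 1 :: real ^ 'n)"
  have "column k ?V \<bullet> d = ?V $ i $ k - ?V $ j $ k" for k
    by (simp add: d_def inner_diff_right inner_axis column_def)
  then have "(\<Sum>k\<in>UNIV. (?V $ i $ k - ?V $ j $ k)\<^sup>2) = d \<bullet> d"
    using parseval[OF o, of d d] by (simp add: power2_eq_square)
  also have "d \<bullet> d = 2"
    using ij by (simp add: d_def inner_diff_left inner_diff_right inner_axis_axis)
  finally show ?thesis
    using ij by (simp add: coeff_at_def entry_laplacian_coeff entrywise_def lam
        flip: sum_distrib_left)
qed

theorem proposition2p1: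
  fixes g g' :: "real \<Rightarrow> real"
    and V :: "'n::finite edge_vec \<Rightarrow> real ^ 'n ^ 'n"
    and lam :: "'n edge_vec \<Rightarrow> real ^ 'n"
    and loss :: "'n edge_vec \<Rightarrow> real"
    and b :: "'n edge_vec"
  assumes "concave_on UNIV g"
    and "mono g"
    and "\<And>t. is_supergradient g t (g' t)"
    and "\<And>x. orthonormal_eigensystem (laplacian (edge_abs x)) (V (edge_abs x)) (lam (edge_abs x))"
    and "\<And>x. loss differentiable (at x)"
  shows "(convex_on UNIV (\<lambda>\<beta>. Q g g' V lam \<beta> b) \<and>
          Q g g' V lam b b = fcls g b \<and>
          (\<forall>\<beta>. fcls g \<beta> \<le> Q g g' V lam \<beta> b)) \<and>
         (\<forall>U U' \<mu> \<mu>'.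
            orthonormal_eigensystem (laplacian (edge_abs b)) U \<mu> \<and>
            orthonormal_eigensystem (laplacian (edge_abs b)) U' \<mu>' \<longrightarrow>
            laplacian_coeff U (entrywise g' \<mu>) = laplacian_coeff U' (entrywise g' \<mu>')) \<and>
         (\<exists>c. \<forall>\<beta>. Q g g' V lam \<beta> 0 = g' 0 * norm1 \<beta> + c) \<and>
         (\<forall>\<beta>. is_arg_min (\<lambda>x. loss x + Q g g' V lam x \<beta>) (\<lambda>_. True) \<beta> \<longrightarrow>
            stationary_point g g' V lam loss \<beta>)"
proof (intro conjI allI impI)
  let ?m = "\<lambda>x. coeff_at g' V lam x"
  have super: "is_supergradient (spectral_sum g) (edge_abs x) (?m x)" for x
    unfolding coeff_at_def using assms(3,4) by (rule spectral_sum_supergradient)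
  have nonneg: "entry (?m x) e \<ge> 0" for x e
    unfolding coeff_at_def
    by (rule laplacian_coeff_nonneg)
      (simp add: entrywise_def supergradient_mono_nonneg[OF assms(2,3)])
  show "convex_on UNIV (\<lambda>\<beta>. Q g g' V lam \<beta> b)"
    unfolding Q_def Q_linear_eq_inner
    by (intro convex_on_const[THEN iffD2] convex_on_add convex_on_cmul convex_on_weighted_abs_sum nonneg) auto
  show "Q g g' V lam b b = fcls g b"
    by (simp add: Q_def)
  show "fcls g \<beta> \<le> Q g g' V lam \<beta> b" for \<beta>
    using super[of b] unfolding is_supergradient_def
    by (auto simp: Q_def Q_linear_eq_inner fcls_def inner_diff_right dest!: spec[of _ "edge_abs \<beta>"])
  show "laplacian_coeff U (entrywise g' \<mu>) = laplacian_coeff U' (entrywise g' \<mu>')"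
    if "orthonormal_eigensystem (laplacian (edge_abs b)) U \<mu> \<and>
      orthonormal_eigensystem (laplacian (edge_abs b)) U' \<mu>'" for U U' \<mu> \<mu>'
    using that laplacian_coeff_eigensystem_unique by blast
  have "Q_linear g' V lam \<beta> 0 = g' 0 * norm1 \<beta>" for \<beta>
    by (simp add: Q_linear_def norm1_def coeff_at_zero[where V = V and lam = lam, OF assms(4)] mult.assoc
        flip: sum_distrib_left)
  then show "\<exists>c. \<forall>\<beta>. Q g g' V lam \<beta> 0 = g' 0 * norm1 \<beta> + c"
    by (auto simp: Q_def)
  show "stationary_point g g' V lam loss \<beta>"
    if "is_arg_min (\<lambda>x. loss x + Q g g' V lam x \<beta>) (\<lambda>_. True) \<beta>" for \<beta>
  proof -
    let ?h = "(1/2) *\<^sub>R ?m \<beta>"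
    have min: "loss \<beta> + ?h \<bullet> edge_abs \<beta> \<le> loss x + ?h \<bullet> edge_abs x" for x
      using that
      by (auto simp: is_arg_min_def Q_def Q_linear_eq_inner not_less dest!: spec[of _ x])
    obtain grad where grad: "GDERIV loss \<beta> :> grad"
      using differentiable_edge_vec_gradient assms(5) by blast
    obtain z where z: "is_subgradient norm1 \<beta> z" "grad + hadamard ?h z = 0"
      by (rule weighted_norm1_minimizer[OF grad _ min]) (simp add: entry_simps nonneg)
    have "hadamard ?h z = (1/2) *\<^sub>R hadamard (?m \<beta>) z"
      by (rule edge_vec_eqI) (simp add: hadamard_def entry_simps entry_edge_lambda)
    then show ?thesis
      using super[of \<beta>] grad z unfolding stationary_point_def Let_def by metis
  qed
qed

end
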